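(* Let $X$ be a normed space, let $r\ge0$, let $\{\omega_t\}_{t\in\mathbb{N}}$ be a weighted sequence, and let $\mathcal{I}$ be an admissible ideal on $\mathbb{N}$. Then $\mathcal{I}$ is maximal if and only if $(\omega_t,\mathcal{I})\text{-}\mathrm{LIM}^r x_t=(\omega_t,\mathcal{I})\text{-}\Gamma_{x_t}^r$ for every sequence $\{x_t\}_{t\in\mathbb{N}}$ in $X$.
   Context: A sequence $\{\omega_t\}_{t\in\mathbb{N}}$ of real numbers is a weighted sequence if there is $\beta>0$ with $\omega_t>\beta$ for all $t\in\mathbb{N}$. An ideal on $\mathbb{N}$ is a family $\mathcal{I}\subseteq\mathcal{P}(\mathbb{N})$ with $\varnothing\in\mathcal{I}$, closed under finite unions and under taking subsets; it is non-trivial if $\mathcal{I}\neq\varnothing$ and $\mathcal{I}\neq\mathcal{P}(\mathbb{N})$, and a non-trivial ideal is admissible if $\{t\}\in\mathcal{I}$ for each $t\in\mathbb{N}$. An ideal $\mathcal{I}$ is maximal if for any ideal $\mathcal{J}$ on $\mathbb{N}$ with $\mathcal{I}\subseteq\mathcal{J}\subseteq\mathcal{P}(\mathbb{N})$, either $\mathcal{J}=\mathcal{I}$ or $\mathcal{J}=\mathcal{P}(\mathbb{N})$. For $r\ge0$, $(\omega_t,\mathcal{I})\text{-}\mathrm{LIM}^r x_t$ is the set of all $x_*\in X$ such that $\{t\in\mathbb{N}:\omega_t\|x_t-x_*\|>r+\varepsilon\}\in\mathcal{I}$ for every $\varepsilon>0$. For a non-trivial ideal $\mathcal{I}$ and $r\ge0$,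 $(\omega_t,\mathcal{I})\text{-}\Gamma_{x_t}^r$ is the set of all $\gamma\in X$ such that $\{t\in\mathbb{N}:\omega_t\|x_t-\gamma\|<r+\varepsilon\}\notin\mathcal{I}$ for every $\varepsilon>0$.
   Formalization: The normed space X is assumed to be non-zero; for X = {0} the claim is false, since the two sets then coincide for every sequence and every admissible ideal, including the non-maximal ideal of finite sets. *)

theory Defs
  imports Complex_Main
begin

definition ideal_on_nat :: "nat set set \<Rightarrow> bool" where
  "ideal_on_nat I \<longleftrightarrow>
     {} \<in> I \<and> (\<forall>A\<in>I. \<forall>B\<in>I. A \<union> B \<in> I) \<and> (\<forall>A\<in>I. \<forall>B. B \<subseteq> A \<longrightarrow> B \<in> I)"

definition nontrivial_ideal :: "nat set set \<Rightarrow> bool" where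
  "nontrivial_ideal I \<longleftrightarrow> ideal_on_nat I \<and> I \<noteq> {} \<and> I \<noteq> Pow UNIV"

definition admissible_ideal :: "nat set set \<Rightarrow> bool" where
  "admissible_ideal I \<longleftrightarrow> nontrivial_ideal I \<and> (\<forall>t. {t} \<in> I)"

definition maximal_ideal :: "nat set set \<Rightarrow> bool" where
  "maximal_ideal I \<longleftrightarrow>
     ideal_on_nat I \<and> (\<forall>J. ideal_on_nat J \<and> I \<subseteq> J \<longrightarrow> J = I \<or> J = Pow UNIV)"

definition weighted_seq :: "(nat \<Rightarrow> real) \<Rightarrow> bool" where
  "weighted_seq \<omega> \<longleftrightarrow> (\<exists>\<beta>>0. \<forall>t. \<omega> t > \<beta>)"

definition rough_ideal_LIM ::
  "(nat \<Rightarrow> real) \<Rightarrow> nat set set \<Rightarrow> real \<Rightarrow> (nat \<Rightarrow> 'a::real_normed_vector) \<Rightarrow> 'a set" where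
  "rough_ideal_LIM \<omega> I r x =
     {l. \<forall>\<epsilon>>0. {t. \<omega> t * norm (x t - l) > r + \<epsilon>} \<in> I}"

definition rough_ideal_cluster ::
  "(nat \<Rightarrow> real) \<Rightarrow> nat set set \<Rightarrow> real \<Rightarrow> (nat \<Rightarrow> 'a::real_normed_vector) \<Rightarrow> 'a set" where
  "rough_ideal_cluster \<omega> I r x =
     {\<gamma>. \<forall>\<epsilon>>0. {t. \<omega> t * norm (x t - \<gamma>) < r + \<epsilon>} \<notin> I}"

end

theory Submission
  imports Defs
begin

text \<open>
  A proper ideal is maximal exactly when it decides every set: of \<open>A\<close> and its complement, one
  belongs to the ideal (\<open>maximal_ideal_iff_decides\<close>).  Up to an arbitrarily small change of
  \<open>\<epsilon>\<close>, the sets tested by the rough limit and by the rough cluster points are complements of each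
  other.  The limit asks that the far indices be in \<open>I\<close>, the cluster condition that the near ones
  not be in \<open>I\<close>.  In a proper ideal the first implies the second; in an ideal that decides every
  set the second implies the first.

  Conversely, an undecided set \<open>A\<close> separates the two notions: let the sequence be \<open>0\<close> on \<open>A\<close> and a
  fixed vector outside \<open>A\<close>, so long that the lower bound of the weights pushes its weighted norm
  beyond \<open>r + 1\<close>.  Then \<open>0\<close> is a cluster point because \<open>A \<notin> I\<close>, and not a limit because
  \<open>- A \<notin> I\<close>.
\<close>

lemma ideal_subset: "ideal_on_nat I \<Longrightarrow> A \<in> I \<Longrightarrow> B \<subseteq> A \<Longrightarrow> B \<in> I"
  unfolding ideal_on_nat_def by blast

lemma notin_ideal_superset: "ideal_on_nat I \<Longrightarrow> A \<notin> I \<Longrightarrow> A \<subseteq> B \<Longrightarrow> B \<notin> I"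
  using ideal_subset[of I B A] by argo

lemma ideal_Un: "ideal_on_nat I \<Longrightarrow> A \<in> I \<Longrightarrow> B \<in> I \<Longrightarrow> A \<union> B \<in> I"
  unfolding ideal_on_nat_def by blast

lemma ideal_eq_Pow_UNIV_iff: "ideal_on_nat I \<Longrightarrow> I = Pow UNIV \<longleftrightarrow> UNIV \<in> I"
  using ideal_subset[of I UNIV] by auto

lemma Compl_notin_proper_ideal:
  assumes "nontrivial_ideal I" "A \<in> I"
  shows "- A \<notin> I"
proof
  assume "- A \<in> I"
  have "ideal_on_nat I"
    using assms(1) unfolding nontrivial_ideal_def by blast
  with \<open>- A \<in> I\<close> have "UNIV \<in> I"
    using ideal_Un[of I A "- A"] assms(2) by simp
  with \<open>ideal_on_nat I\<close> have "I = Pow UNIV"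
    by (simp only: ideal_eq_Pow_UNIV_iff)
  with assms(1) show False
    unfolding nontrivial_ideal_def by argo
qed

text \<open>
  Maximality is tested against the ideal generated by \<open>I\<close> and \<open>A\<close>, whose members are the subsets
  of the sets \<open>C \<union> A\<close> with \<open>C \<in> I\<close>.  It is all of \<open>Pow UNIV\<close> only if some \<open>C \<in> I\<close> covers the
  complement of \<open>A\<close>.
\<close>

lemma ideal_generated_by_adding_set:
  assumes "ideal_on_nat I"
  shows "ideal_on_nat {B. \<exists>C\<in>I. B \<subseteq> C \<union> A}" (is "ideal_on_nat ?J")
proof -
  have "{} \<in> ?J"
    using assms unfolding ideal_on_nat_def by auto
  moreover have "P \<union> Q \<in> ?J" if "P \<in> ?J" "Q \<in> ?J" for P Q
  proof -
    obtain C D where CD: "C \<in> I" "D \<in> I" "P \<subseteq> C \<union> A" "Q \<subseteq> D \<union> A"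
      using \<open>P \<in> ?J\<close> \<open>Q \<in> ?J\<close> by auto
    then have "P \<union> Q \<subseteq> (C \<union> D) \<union> A"
      by auto
    with ideal_Un[OF assms CD(1,2)] show ?thesis
      by auto
  qed
  moreover have "Q \<in> ?J" if "P \<in> ?J" "Q \<subseteq> P" for P Q
  proof -
    obtain C where "C \<in> I" "P \<subseteq> C \<union> A"
      using \<open>P \<in> ?J\<close> by auto
    with \<open>Q \<subseteq> P\<close> have "Q \<subseteq> C \<union> A"
      by simp
    with \<open>C \<in> I\<close> show ?thesis
      by auto
  qed
  ultimately show ?thesis
    unfolding ideal_on_nat_def by simp
qed

lemma maximal_ideal_iff_decides:
  assumes "ideal_on_nat I"
  shows "maximal_ideal I \<longleftrightarrow> (\<forall>A. A \<in> I \<or> - A \<in> I)"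
proof
  assume max: "maximal_ideal I"
  have "- A \<in> I" if "A \<notin> I" for A
  proof -
    let ?J = "{B. \<exists>C\<in>I. B \<subseteq> C \<union> A}"
    have "{} \<in> I"
      using assms unfolding ideal_on_nat_def by simp
    then have "A \<in> ?J"
      by auto
    with \<open>A \<notin> I\<close> have "?J \<noteq> I"
      by metis
    have "I \<subseteq> ?J"
      by auto
    with ideal_generated_by_adding_set[OF assms] have "?J = I \<or> ?J = Pow UNIV"
      by (intro max[unfolded maximal_ideal_def, THEN conjunct2, rule_format] conjI)
    with \<open>?J \<noteq> I\<close> have "?J = Pow UNIV"
      by (elim disjE) (erule (1) notE)
    then have "UNIV \<in> ?J"
      by simp
    then obtain C where "C \<in> I" "UNIV \<subseteq> C \<union> A"
      by auto
    then have "- A \<subseteq> C"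
      by auto
    with \<open>C \<in> I\<close> show ?thesis
      by (rule ideal_subset[OF assms])
  qed
  then show "\<forall>A. A \<in> I \<or> - A \<in> I"
    by blast
next
  assume dec: "\<forall>A. A \<in> I \<or> - A \<in> I"
  show "maximal_ideal I"
    unfolding maximal_ideal_def
  proof (intro conjI allI impI disjCI)
    fix J assume "ideal_on_nat J \<and> I \<subseteq> J" and "J \<noteq> Pow UNIV"
    then have J: "ideal_on_nat J" "I \<subseteq> J" and "UNIV \<notin> J"
      using ideal_eq_Pow_UNIV_iff[of J] by simp_all
    have "A \<in> I" if "A \<in> J" for A
    proof (rule ccontr)
      assume "A \<notin> I"
      with dec \<open>I \<subseteq> J\<close> have "- A \<in> J"
        by blast
      with ideal_Un[OF J(1) that] have "UNIV \<in> J"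
        by fastforce
      with \<open>UNIV \<notin> J\<close> show False ..
    qed
    with \<open>I \<subseteq> J\<close> show "J = I"
      by blast
  qed (rule assms)
qed

lemma rough_ideal_LIM_subset_cluster:
  assumes "nontrivial_ideal I"
  shows "rough_ideal_LIM \<omega> I r x \<subseteq> rough_ideal_cluster \<omega> I r x"
proof
  fix l assume l: "l \<in> rough_ideal_LIM \<omega> I r x"
  have I: "ideal_on_nat I"
    using assms unfolding nontrivial_ideal_def by blast
  have "{t. \<omega> t * norm (x t - l) < r + \<epsilon>} \<notin> I" if "\<epsilon> > 0" for \<epsilon>
  proof -
    (* Halving \<epsilon> absorbs the boundary case: the complement of the far set is given by a
       non-strict inequality, the near set by a strict one. *)
    have "{t. \<omega> t * norm (x t - l) > r + \<epsilon>/2} \<in> I"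
      using l that unfolding rough_ideal_LIM_def by simp
    then have "- {t. \<omega> t * norm (x t - l) > r + \<epsilon>/2} \<notin> I"
      by (rule Compl_notin_proper_ideal[OF assms])
    moreover have "- {t. \<omega> t * norm (x t - l) > r + \<epsilon>/2} \<subseteq> {t. \<omega> t * norm (x t - l) < r + \<epsilon>}"
      using that by auto
    ultimately show ?thesis
      by (rule notin_ideal_superset[OF I])
  qed
  then show "l \<in> rough_ideal_cluster \<omega> I r x"
    unfolding rough_ideal_cluster_def by blast
qed

lemma rough_ideal_cluster_subset_LIM:
  assumes "ideal_on_nat I" and dec: "\<And>A. A \<in> I \<or> - A \<in> I"
  shows "rough_ideal_cluster \<omega> I r x \<subseteq> rough_ideal_LIM \<omega> I r x"
proof
  fix l assume l: "l \<in> rough_ideal_cluster \<omega> I r x"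
  have "{t. \<omega> t * norm (x t - l) > r + \<epsilon>} \<in> I" if "\<epsilon> > 0" for \<epsilon>
  proof -
    have "- {t. \<omega> t * norm (x t - l) < r + \<epsilon>} \<in> I"
      using l that dec unfolding rough_ideal_cluster_def by blast
    then show ?thesis
      by (rule ideal_subset[OF assms(1)]) auto
  qed
  then show "l \<in> rough_ideal_LIM \<omega> I r x"
    unfolding rough_ideal_LIM_def by blast
qed

lemma undecided_set_separates_cluster_from_LIM:
  fixes \<omega> :: "nat \<Rightarrow> real" and v :: "'a::real_normed_vector"
  assumes I: "ideal_on_nat I" and "A \<notin> I" and "- A \<notin> I"
    and "weighted_seq \<omega>" and "r \<ge> 0" and "v \<noteq> 0"
  shows "\<exists>x :: nat \<Rightarrow> 'a. 0 \<in> rough_ideal_cluster \<omega> I r x \<and> 0 \<notin> rough_ideal_LIM \<omega> I r x"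
proof -
  obtain \<beta> where "\<beta> > 0" and \<beta>: "\<And>t. \<omega> t > \<beta>"
    using assms(4) unfolding weighted_seq_def by blast
  (* The vector has norm (r + 1) / \<beta>, which a weight above \<beta> stretches beyond r + 1. *)
  define w where "w = ((r + 1) / (\<beta> * norm v)) *\<^sub>R v"
  have norm_w: "norm w = (r + 1) / \<beta>"
    using \<open>\<beta> > 0\<close> \<open>r \<ge> 0\<close> \<open>v \<noteq> 0\<close> unfolding w_def by simp
  have far: "\<omega> t * norm w > r + 1" for t
  proof -
    have "\<beta> * norm w < \<omega> t * norm w"
      using \<beta> \<open>\<beta> > 0\<close> \<open>r \<ge> 0\<close> unfolding norm_w by (intro mult_strict_right_mono) auto
    then show ?thesis
      using \<open>\<beta> > 0\<close> unfolding norm_w by simp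
  qed
  define x where "x = (\<lambda>t. if t \<in> A then 0 else w)"
  have "{t. \<omega> t * norm (x t - 0) < r + \<epsilon>} \<notin> I" if "\<epsilon> > 0" for \<epsilon>
  proof -
    have "A \<subseteq> {t. \<omega> t * norm (x t - 0) < r + \<epsilon>}"
      using \<open>r \<ge> 0\<close> that unfolding x_def by auto
    with \<open>A \<notin> I\<close> show ?thesis
      by (rule notin_ideal_superset[OF I])
  qed
  then have "0 \<in> rough_ideal_cluster \<omega> I r x"
    unfolding rough_ideal_cluster_def by blast
  moreover have "- A \<subseteq> {t. \<omega> t * norm (x t - 0) > r + 1}"
    using far unfolding x_def by auto
  with \<open>- A \<notin> I\<close> have "{t. \<omega> t * norm (x t - 0) > r + 1} \<notin> I"
    by (rule notin_ideal_superset[OF I])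
  then have "0 \<notin> rough_ideal_LIM \<omega> I r x"
    unfolding rough_ideal_LIM_def using zero_less_one by blast
  ultimately show ?thesis
    by blast
qed

theorem theorem4p9:
  fixes \<omega> :: "nat \<Rightarrow> real" and I :: "nat set set" and r :: real
  assumes "\<exists>v::'a::real_normed_vector. v \<noteq> 0"
    and "r \<ge> 0"
    and "weighted_seq \<omega>"
    and "admissible_ideal I"
  shows "maximal_ideal I \<longleftrightarrow>
    (\<forall>x :: nat \<Rightarrow> 'a. rough_ideal_LIM \<omega> I r x = rough_ideal_cluster \<omega> I r x)"
proof -
  have nontriv: "nontrivial_ideal I"
    using assms(4) unfolding admissible_ideal_def by blast
  then have I: "ideal_on_nat I"
    unfolding nontrivial_ideal_def by blast
  obtain v :: 'a where "v \<noteq> 0"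
    using assms(1) by blast
  show ?thesis
    unfolding maximal_ideal_iff_decides[OF I]
  proof
    assume dec: "\<forall>A. A \<in> I \<or> - A \<in> I"
    show "\<forall>x :: nat \<Rightarrow> 'a. rough_ideal_LIM \<omega> I r x = rough_ideal_cluster \<omega> I r x"
      using dec
      by (intro allI subset_antisym rough_ideal_LIM_subset_cluster[OF nontriv]
          rough_ideal_cluster_subset_LIM[OF I]) simp
  next
    assume eq: "\<forall>x :: nat \<Rightarrow> 'a. rough_ideal_LIM \<omega> I r x = rough_ideal_cluster \<omega> I r x"
    show "\<forall>A. A \<in> I \<or> - A \<in> I"
    proof (rule ccontr)
      assume "\<not> (\<forall>A. A \<in> I \<or> - A \<in> I)"
      then obtain A where "A \<notin> I" "- A \<notin> I"
        by blast
      from undecided_set_separates_cluster_from_LIM[OF I this assms(3,2) \<open>v \<noteq> 0\<close>] eq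
      show False
        by blast
    qed
  qed
qed

end
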